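(* Let $n\ge1$, $c>0$, $q\in\mathbb{N}$, and let $f:[0,1]\to\mathbb{R}^n$ be a curve such that $f(0)=0$ and $f$ is twice continuously differentiable at $0$. Assume that $f'(0)$ is $(c,q)$-badly approximable by rationals. Then there exists a constant $C>0$, depending only on $c,q,n,f$, such that for every $\varepsilon>0$ and every $\lambda\ge A(\varepsilon)$, where $$A(\varepsilon)=C\,\varepsilon^{-\left((q+1)n(n+1)+q\sum_{i=0}^{n-2}(i+1)(2n-i)+1\right)},$$ the projection of $\lambda f([0,1])$ onto $\mathbb{T}^n$ is $\varepsilon$-dense.
   Context: $\mathbb{T}^n=\mathbb{R}^n/\mathbb{Z}^n$. For $z\in\mathbb{R}$ (or $\mathbb{T}$), $\|z\|_{\mathbb{T}}=\inf_{k\in\mathbb{Z}}|z-k|$; $\|\cdot\|$ is the $\ell^1$-norm. For $c>0$ and $q\in\mathbb{N}$, a vector $x\in\mathbb{R}^n$ is $(c,q)$-badly approximable by rationals if $\|\langle x,\nu\rangle\|_{\mathbb{T}}>c/\|\nu\|^q$ for every $\nu\in\mathbb{Z}^n\setminus\{0\}$. A subset of $\mathbb{T}^n$ is $\varepsilon$-dense if every point of $\mathbb{T}^n$ is within distance $\varepsilon$ of it, with respect to the quotient metric induced by $\|\cdot\|$. "Twice continuously differentiable at $0$" means that $f$ is $C^2$ on some interval $[0,\delta)$, $\delta>0$ (one-sided derivatives at $0$). For $n=1$ the empty sum is $0$. *)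

theory Defs
  imports "HOL-Analysis.Analysis"
begin

definition l1_norm :: "real ^ 'n \<Rightarrow> real" where
  "l1_norm x = (\<Sum>i\<in>UNIV. \<bar>x $ i\<bar>)"

definition circle_norm :: "real \<Rightarrow> real" where
  "circle_norm z = (INF k::int. \<bar>z - of_int k\<bar>)"

definition int_lattice :: "(real ^ 'n) set" where
  "int_lattice = {v. \<forall>i. v $ i \<in> \<int>}"

definition badly_approximable :: "real \<Rightarrow> nat \<Rightarrow> real ^ 'n \<Rightarrow> bool" where
  "badly_approximable c q x \<longleftrightarrow>
     (\<forall>\<nu>\<in>int_lattice - {0}. circle_norm (x \<bullet> \<nu>) > c / l1_norm \<nu> ^ q)"

definition lattice_rel :: "((real ^ 'n) \<times> (real ^ 'n)) set" where
  "lattice_rel = {(x, y). x - y \<in> int_lattice}"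

definition torus :: "(real ^ 'n) set set" where
  "torus = UNIV // lattice_rel"

definition torus_proj :: "real ^ 'n \<Rightarrow> (real ^ 'n) set" where
  "torus_proj x = lattice_rel `` {x}"

text \<open>Since the lattice acts by isometries, the quotient metric on the torus is the infimum of
  the \<open>l\<^sup>1\<close>-distances between representatives; no chains are needed.\<close>

definition torus_dist :: "(real ^ 'n) set \<Rightarrow> (real ^ 'n) set \<Rightarrow> real" where
  "torus_dist P Q = (INF (x, y)\<in>P \<times> Q. l1_norm (x - y))"

definition eps_dense :: "real \<Rightarrow> (real ^ 'n) set set \<Rightarrow> bool" where
  "eps_dense \<epsilon> S \<longleftrightarrow> S \<subseteq> torus \<and> (\<forall>P\<in>torus. \<exists>Q\<in>S. torus_dist P Q \<le> \<epsilon>)"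

text \<open>The derivatives are taken within \<open>[0, \<delta>)\<close>, hence they are one-sided at 0 and two-sided
  elsewhere. The bound \<open>\<delta> \<le> 1\<close> keeps the values of \<open>f\<close> outside \<open>[0, 1]\<close> irrelevant.\<close>

definition twice_cont_diff_at_0 :: "(real \<Rightarrow> real ^ 'n) \<Rightarrow> bool" where
  "twice_cont_diff_at_0 f \<longleftrightarrow>
     (\<exists>\<delta> f' f''. 0 < \<delta> \<and> \<delta> \<le> 1 \<and>
        (\<forall>t\<in>{0..<\<delta>}. (f has_vector_derivative f' t) (at t within {0..<\<delta>})) \<and>
        (\<forall>t\<in>{0..<\<delta>}. (f' has_vector_derivative f'' t) (at t within {0..<\<delta>})) \<and>
        continuous_on {0..<\<delta>} f'')"

text \<open>For \<open>n \<ge> 1\<close> the index range \<open>i < n - 1\<close> is \<open>0 \<le> i \<le> n - 2\<close>, and it is empty for \<open>n = 1\<close>,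
  whereas \<open>{0..n - 2}\<close> would be \<open>{0}\<close> because subtraction truncates.\<close>

definition density_exponent :: "nat \<Rightarrow> nat \<Rightarrow> nat" where
  "density_exponent n q =
     (q + 1) * n * (n + 1) + q * (\<Sum>i<n - 1. (i + 1) * (2 * n - i)) + 1"

end

theory Submission
  imports Defs
begin

text \<open>Near 0 the curve is \<open>t f'(0) + O(t\<^sup>2)\<close>, so \<open>L f(s / L)\<close> for \<open>0 \<le> s \<le> T\<close> follows the linear flow
  \<open>s x\<close>, \<open>x = f'(0)\<close>, up to an error \<open>O(T\<^sup>2 / L)\<close>. It therefore suffices that the linear flow is
  \<open>\<epsilon>\<close>-dense after a time \<open>T\<close> of order \<open>(1 / \<epsilon>) ^ (n + q)\<close>, because \<open>2 (n + q) + 1\<close> does not exceed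
  the exponent of the theorem.

  For the flow, let \<open>D\<close> be a product over the coordinates of trigonometric polynomials of degree
  \<open>N\<close> of order \<open>1 / \<epsilon>\<close> with triangular coefficients, and \<open>E\<^sub>j = (1 - e(y\<^sub>j)) D\<close>. If the flow avoids the
  \<open>\<epsilon>\<close>-ball around \<open>\<theta>\<close>, then \<open>\<Sum>\<^sub>j |E\<^sub>j|\<^sup>2 \<ge> (\<epsilon> / n)\<^sup>2 |D|\<^sup>2\<close> along it. The time averages of both sides differ
  from their means over the torus by \<open>O(1 / T)\<close>, as \<open>\<bar>x \<bullet> \<nu>\<bar>\<close> is bounded below on the relevant
  frequencies; but the means satisfy the opposite inequality, since the difference sequence of the
  coefficients has small square sum. So \<open>T\<close> is bounded.\<close>

section \<open>Time averages of trigonometric sums\<close>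

lemma norm_integral_cis_le:
  fixes z :: complex
  assumes "w \<noteq> 0" "0 \<le> T"
  shows "cmod (integral {0..T} (\<lambda>s. z * cis (w * s))) \<le> cmod z * (2 / \<bar>w\<bar>)"
proof -
  define F where "F s = z * cis (w * s) / (\<i> * of_real w)" for s
  have "((\<lambda>s. z * cis (w * s)) has_integral F T - F 0) {0..T}"
  proof (rule fundamental_theorem_of_calculus)
    fix s assume "s \<in> {0..T}"
    have "((\<lambda>s. z * cis (w * s) / (\<i> * of_real w)) has_derivative
        (\<lambda>h. h *\<^sub>R (z * cis (w * s)))) (at s within {0..T})"
      using assms(1) by (auto intro!: derivative_eq_intros simp: field_simps scaleR_conv_of_real)
    then show "(F has_vector_derivative z * cis (w * s)) (at s within {0..T})"
      unfolding has_vector_derivative_def F_def .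
  qed (fact assms)
  then have "integral {0..T} (\<lambda>s. z * cis (w * s)) = F T - F 0"
    by (rule integral_unique)
  also have "\<dots> = z / (\<i> * of_real w) * (cis (w * T) - 1)"
    by (simp add: F_def right_diff_distrib)
  also have "cmod \<dots> = cmod z / \<bar>w\<bar> * cmod (cis (w * T) - 1)"
    by (simp add: norm_mult norm_divide)
  also have "\<dots> \<le> cmod z / \<bar>w\<bar> * 2"
    using norm_triangle_ineq4[of "cis (w * T)" 1] by (intro mult_left_mono) auto
  finally show ?thesis by simp
qed

text \<open>Expanding the square, the diagonal terms are constant in time and give the main term.
  Each off-diagonal term oscillates with frequency at least \<open>\<rho>\<close>, so its integral
  is bounded independently of \<open>T\<close>.\<close>

lemma mean_square_trig_sum:
  fixes a :: "'a \<Rightarrow> complex" and w :: "'a \<Rightarrow> real"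
  assumes "finite I" "0 \<le> T" "0 < \<rho>"
    and sep: "\<And>i k. i \<in> I \<Longrightarrow> k \<in> I \<Longrightarrow> i \<noteq> k \<Longrightarrow> \<rho> \<le> \<bar>w i - w k\<bar>"
  shows "\<bar>integral {0..T} (\<lambda>s. (cmod (\<Sum>i\<in>I. a i * cis (w i * s)))\<^sup>2) - T * (\<Sum>i\<in>I. (cmod (a i))\<^sup>2)\<bar>
    \<le> (\<Sum>i\<in>I. cmod (a i))\<^sup>2 * (2 / \<rho>)"
proof -
  define J where "J i k = integral {0..T} (\<lambda>s. a i * cnj (a k) * cis ((w i - w k) * s))" for i k
  define G where "G s = (\<Sum>i\<in>I. a i * cis (w i * s))" for s
  have J: "((\<lambda>s. a i * cnj (a k) * cis ((w i - w k) * s)) has_integral J i k) {0..T}" for i k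
    unfolding J_def by (intro integrable_integral integrable_continuous_real continuous_intros)
  have diag: "J i i = of_real (T * (cmod (a i))\<^sup>2)" for i
    unfolding J_def using assms(2) complex_norm_square[of "a i"] by (simp add: scaleR_conv_of_real)
  have "complex_of_real ((cmod (G s))\<^sup>2) = (\<Sum>i\<in>I. \<Sum>k\<in>I. a i * cnj (a k) * cis ((w i - w k) * s))"
    for s
  proof -
    have "complex_of_real ((cmod (G s))\<^sup>2) = G s * cnj (G s)"
      by (simp only: complex_norm_square)
    also have "\<dots> = (\<Sum>i\<in>I. \<Sum>k\<in>I. (a i * cis (w i * s)) * (cnj (a k) * cis (- (w k * s))))"
      by (simp add: G_def sum_product cis_cnj)
    also have "\<dots> = (\<Sum>i\<in>I. \<Sum>k\<in>I. a i * cnj (a k) * cis ((w i - w k) * s))"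
    proof (intro sum.cong refl)
      fix i k
      have "cis ((w i - w k) * s) = cis (w i * s) * cis (- (w k * s))"
        by (simp add: cis_mult algebra_simps)
      then show "a i * cis (w i * s) * (cnj (a k) * cis (- (w k * s)))
          = a i * cnj (a k) * cis ((w i - w k) * s)" by simp
    qed
    finally show ?thesis .
  qed
  moreover have "((\<lambda>s. \<Sum>i\<in>I. \<Sum>k\<in>I. a i * cnj (a k) * cis ((w i - w k) * s)) has_integral
      (\<Sum>i\<in>I. \<Sum>k\<in>I. J i k)) {0..T}"
    by (intro has_integral_sum assms(1) J)
  ultimately have "((\<lambda>s. complex_of_real ((cmod (G s))\<^sup>2)) has_integral (\<Sum>i\<in>I. \<Sum>k\<in>I. J i k)) {0..T}"
    by presburger
  from has_integral_linear[OF this bounded_linear_Re]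
  have int: "integral {0..T} (\<lambda>s. (cmod (G s))\<^sup>2) = Re (\<Sum>i\<in>I. \<Sum>k\<in>I. J i k)"
    by (intro integral_unique) (simp add: o_def)
  \<comment> \<open>Subtracting this diagonal matrix from \<open>J\<close> puts the main term and
    the oscillating terms under one entrywise estimate.\<close>
  define D where "D i k = (if i = k then complex_of_real (T * (cmod (a i))\<^sup>2) else 0)" for i k
  have sumD: "(\<Sum>i\<in>I. \<Sum>k\<in>I. D i k) = complex_of_real (T * (\<Sum>i\<in>I. (cmod (a i))\<^sup>2))"
    by (simp add: D_def assms(1) sum_distrib_left)
  have est: "cmod (J i k - D i k) \<le> cmod (a i) * cmod (a k) * (2 / \<rho>)" if "i \<in> I" "k \<in> I" for i k
  proof (cases "i = k")
    case True
    then show ?thesis using assms(3) by (simp add: D_def diag)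
  next
    case False
    then have "\<rho> \<le> \<bar>w i - w k\<bar>" using sep that by blast
    with assms(3) have "w i - w k \<noteq> 0" "2 / \<bar>w i - w k\<bar> \<le> 2 / \<rho>"
      by (auto intro!: divide_left_mono mult_pos_pos)
    have "cmod (J i k - D i k) \<le> cmod (a i * cnj (a k)) * (2 / \<bar>w i - w k\<bar>)"
      unfolding J_def D_def using False norm_integral_cis_le[OF \<open>w i - w k \<noteq> 0\<close> assms(2)] by simp
    also have "\<dots> \<le> cmod (a i * cnj (a k)) * (2 / \<rho>)"
      by (intro mult_left_mono) (use \<open>2 / \<bar>w i - w k\<bar> \<le> 2 / \<rho>\<close> in auto)
    finally show ?thesis by (simp add: norm_mult)
  qed
  have "\<bar>integral {0..T} (\<lambda>s. (cmod (G s))\<^sup>2) - T * (\<Sum>i\<in>I. (cmod (a i))\<^sup>2)\<bar>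
      = \<bar>Re ((\<Sum>i\<in>I. \<Sum>k\<in>I. J i k) - (\<Sum>i\<in>I. \<Sum>k\<in>I. D i k))\<bar>"
    unfolding sumD int by simp
  also have "\<dots> \<le> cmod ((\<Sum>i\<in>I. \<Sum>k\<in>I. J i k) - (\<Sum>i\<in>I. \<Sum>k\<in>I. D i k))"
    by (rule abs_Re_le_cmod)
  also have "\<dots> = cmod (\<Sum>i\<in>I. \<Sum>k\<in>I. J i k - D i k)"
    by (simp add: sum_subtractf)
  also have "\<dots> \<le> (\<Sum>i\<in>I. \<Sum>k\<in>I. cmod (a i) * cmod (a k) * (2 / \<rho>))"
    by (intro sum_norm_le est)
  also have "\<dots> = (\<Sum>i\<in>I. cmod (a i))\<^sup>2 * (2 / \<rho>)"
    unfolding power2_eq_square sum_product by (simp only: sum_distrib_right)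
  finally show ?thesis unfolding G_def .
qed

text \<open>The norm on the right is 2 |sin(pi y)|, and concavity puts the sine above its chord on
  [0, pi/2], so it is at least 4 |y|. The weaker bound suffices later.\<close>

lemma abs_le_norm_one_minus_cis:
  assumes "\<bar>y\<bar> \<le> 1 / 2"
  shows "\<bar>y\<bar> \<le> cmod (1 - cis (2 * pi * y))"
proof -
  have conc: "concave_on {0..pi / 2} sin"
    by (rule f''_le0_imp_concave[where f' = cos and f'' = "\<lambda>x. - sin x"])
      (auto intro!: derivative_eq_intros sin_ge_zero)
  have "\<bar>y\<bar> \<le> sin (pi * \<bar>y\<bar>)"
  proof -
    have "(1 - 2 * \<bar>y\<bar>) * sin 0 + (2 * \<bar>y\<bar>) * sin (pi / 2)
        \<le> sin ((1 - 2 * \<bar>y\<bar>) *\<^sub>R 0 + (2 * \<bar>y\<bar>) *\<^sub>R (pi / 2))"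
      by (rule concave_onD[OF conc]) (use assms in auto)
    then show ?thesis by (simp add: mult.commute)
  qed
  then have "y\<^sup>2 \<le> (sin (pi * \<bar>y\<bar>))\<^sup>2"
    by (metis abs_le_square_iff abs_ge_zero abs_of_nonneg order_trans power2_abs)
  also have "\<dots> = (sin (pi * y))\<^sup>2"
    by (cases "y \<ge> 0") (auto simp: abs_if)
  finally have "y\<^sup>2 \<le> (sin (pi * y))\<^sup>2" .
  have "cos (2 * pi * y) = 1 - 2 * (sin (pi * y))\<^sup>2"
    using cos_double_sin[of "pi * y"] by (simp add: mult.assoc)
  moreover have "(cmod (1 - cis (2 * pi * y)))\<^sup>2 = 2 - 2 * cos (2 * pi * y)"
    using sin_cos_squared_add[of "2 * pi * y"]
    unfolding cmod_power2 by (simp add: power2_eq_square algebra_simps)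
  ultimately have "y\<^sup>2 \<le> (cmod (1 - cis (2 * pi * y)))\<^sup>2"
    using \<open>y\<^sup>2 \<le> (sin (pi * y))\<^sup>2\<close> zero_le_power2[of y] by linarith
  then show ?thesis
    by (metis abs_le_square_iff abs_norm_cancel)
qed

text \<open>Multiplying out, the product becomes an exponential sum over integer vectors
  \<open>g\<close> with frequencies 2 pi times the inner product of \<open>x\<close> and
  \<open>g\<close>. The shift \<open>\<theta>\<close> only changes phases, and both coefficient sums
  factor over the coordinates.\<close>

lemma mean_square_prod_trig_poly:
  fixes u :: "'n::finite \<Rightarrow> int \<Rightarrow> real" and x \<theta> :: "real ^ 'n"
  assumes "finite K" "0 \<le> T" "0 < \<rho>"
    and sep: "\<And>g h. g \<in> UNIV \<rightarrow> K \<Longrightarrow> h \<in> UNIV \<rightarrow> K \<Longrightarrow> g \<noteq> h \<Longrightarrow>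
      \<rho> \<le> \<bar>x \<bullet> (\<chi> j. of_int (g j - h j))\<bar>"
  shows "\<bar>integral {0..T} (\<lambda>s. (cmod (\<Prod>j\<in>UNIV. \<Sum>k\<in>K.
        of_real (u j k) * cis (2 * pi * of_int k * (s * x $ j - \<theta> $ j))))\<^sup>2)
      - T * (\<Prod>j\<in>UNIV. \<Sum>k\<in>K. (u j k)\<^sup>2)\<bar>
    \<le> (\<Prod>j\<in>UNIV. \<Sum>k\<in>K. \<bar>u j k\<bar>)\<^sup>2 / \<rho>"
proof -
  define I where "I = PiE (UNIV :: 'n set) (\<lambda>_. K)"
  define a where "a g = (\<Prod>j\<in>UNIV. of_real (u j (g j)) * cis (- (2 * pi * of_int (g j) * \<theta> $ j)))"
    for g :: "'n \<Rightarrow> int"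
  define w where "w g = 2 * pi * (\<Sum>j\<in>UNIV. of_int (g j) * x $ j)" for g :: "'n \<Rightarrow> int"
  have "finite I" unfolding I_def by (intro finite_PiE assms(1)) auto
  have cis_sum: "(\<Prod>j\<in>A. cis (v j)) = cis (\<Sum>j\<in>A. v j)" if "finite A" for A :: "'n set" and v
    using that by (induction A rule: finite_induct) (auto simp: cis_mult)
  have exp: "(\<Prod>j\<in>UNIV. \<Sum>k\<in>K. of_real (u j k) * cis (2 * pi * of_int k * (s * x $ j - \<theta> $ j)))
      = (\<Sum>g\<in>I. a g * cis (w g * s))" for s
  proof -
    have "(\<Prod>j\<in>UNIV. of_real (u j (g j)) * cis (2 * pi * of_int (g j) * (s * x $ j - \<theta> $ j)))
        = a g * cis (w g * s)" for g
    proof -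
      have "w g * s = (\<Sum>j\<in>UNIV. 2 * pi * of_int (g j) * x $ j * s)"
        by (simp add: w_def sum_distrib_left sum_distrib_right mult_ac)
      then have "cis (w g * s) = (\<Prod>j\<in>UNIV. cis (2 * pi * of_int (g j) * x $ j * s))"
        by (simp add: cis_sum)
      then have "a g * cis (w g * s) = (\<Prod>j\<in>UNIV. of_real (u j (g j)) *
          (cis (- (2 * pi * of_int (g j) * \<theta> $ j)) * cis (2 * pi * of_int (g j) * x $ j * s)))"
        by (simp add: a_def prod.distrib mult_ac)
      then show ?thesis by (simp add: cis_mult algebra_simps)
    qed
    then show ?thesis
      unfolding I_def by (subst prod_sum_PiE) (use assms(1) in auto)
  qed
  have cmod_a: "cmod (a g) = (\<Prod>j\<in>UNIV. \<bar>u j (g j)\<bar>)" for g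
    by (simp add: a_def norm_mult flip: prod_norm)
  have sum1: "(\<Sum>g\<in>I. cmod (a g)) = (\<Prod>j\<in>UNIV. \<Sum>k\<in>K. \<bar>u j k\<bar>)"
    unfolding I_def cmod_a by (subst prod_sum_PiE) (use assms(1) in auto)
  have sum2: "(\<Sum>g\<in>I. (cmod (a g))\<^sup>2) = (\<Prod>j\<in>UNIV. \<Sum>k\<in>K. (u j k)\<^sup>2)"
    unfolding I_def cmod_a by (subst prod_sum_PiE) (use assms(1) in \<open>auto simp: prod_power_distrib\<close>)
  \<comment> \<open>The factor 2, taken from 2 pi, cancels the 2 in the bound for a single
    trigonometric sum.\<close>
  have "2 * \<rho> \<le> \<bar>w g - w h\<bar>" if "g \<in> I" "h \<in> I" "g \<noteq> h" for g h
  proof -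
    have "w g - w h = 2 * pi * (x \<bullet> (\<chi> j. of_int (g j - h j)))"
      by (simp add: w_def inner_vec_def sum_subtractf algebra_simps)
    then have "\<bar>w g - w h\<bar> = 2 * pi * \<bar>x \<bullet> (\<chi> j. of_int (g j - h j))\<bar>"
      by (simp add: abs_mult)
    moreover have "\<rho> \<le> \<bar>x \<bullet> (\<chi> j. of_int (g j - h j))\<bar>"
      using that by (intro sep) (auto simp: I_def)
    ultimately show ?thesis
      using mult_mono[of 2 "2 * pi" \<rho> "\<bar>x \<bullet> (\<chi> j. of_int (g j - h j))\<bar>"] assms(3) pi_gt3 by simp
  qed
  from mean_square_trig_sum[OF \<open>finite I\<close> assms(2) _ this, where a = a] assms(3)
  show ?thesis by (simp add: exp sum1 sum2)
qed

section \<open>Triangular coefficients and their differences\<close>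

text \<open>These are the Fourier coefficients of \<open>N\<close> times the Fejer kernel, kept as
  integers to avoid a division by \<open>N\<close>.\<close>

definition tri :: "nat \<Rightarrow> int \<Rightarrow> real" where
  "tri N k = of_int (max 0 (int N - \<bar>k\<bar>))"

definition dtri :: "nat \<Rightarrow> int \<Rightarrow> real" where
  "dtri N k = tri N k - tri N (k - 1)"

abbreviation trig_poly :: "(int \<Rightarrow> real) \<Rightarrow> nat \<Rightarrow> real \<Rightarrow> complex" where
  "trig_poly u N y \<equiv> \<Sum>k\<in>{- int N..int N}. of_real (u k) * cis (2 * pi * of_int k * y)"

text \<open>Multiplication by \<open>cis (2 * pi * y)\<close> shifts the coefficients by one. No
  boundary terms arise, because \<open>tri N\<close> vanishes at \<open>N\<close> and at
  \<open>- N - 1\<close>.\<close>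

lemma trig_poly_dtri: "trig_poly (dtri N) N y = (1 - cis (2 * pi * y)) * trig_poly (tri N) N y"
proof -
  let ?e = "\<lambda>k::int. cis (2 * pi * of_int k * y)"
  let ?F = "\<lambda>k. of_real (tri N (k - 1)) * ?e k"
  have "cis (2 * pi * y) * trig_poly (tri N) N y = (\<Sum>k\<in>{- int N..int N}. ?F (k + 1))"
    unfolding sum_distrib_left
  proof (intro sum.cong refl)
    fix k :: int
    have "?e (k + 1) = cis (2 * pi * y) * ?e k"
      by (simp add: cis_mult algebra_simps)
    then show "cis (2 * pi * y) * (of_real (tri N k) * ?e k) = ?F (k + 1)"
      by simp
  qed
  also have "\<dots> = (\<Sum>k\<in>{- int N + 1..int N + 1}. ?F k)"
    by (rule sum.reindex_bij_witness[of _ "\<lambda>k. k - 1" "\<lambda>k. k + 1"]) auto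
  also have "\<dots> = (\<Sum>k\<in>{- int N..int N + 1}. ?F k)"
    by (rule sum.mono_neutral_left) (auto simp: tri_def)
  also have "\<dots> = (\<Sum>k\<in>{- int N..int N}. ?F k)"
    by (rule sum.mono_neutral_right) (auto simp: tri_def)
  finally show ?thesis
    by (simp add: dtri_def left_diff_distrib sum_subtractf)
qed

text \<open>The triangular function is 1-Lipschitz.\<close>

lemma dtri_abs_le: "\<bar>dtri N k\<bar> \<le> 1"
proof -
  have "\<bar>max 0 (int N - \<bar>k\<bar>) - max 0 (int N - \<bar>k - 1\<bar>)\<bar> \<le> 1"
    by linarith
  then show ?thesis
    unfolding dtri_def tri_def of_int_diff[symmetric] of_int_abs[symmetric] by linarith
qed

lemma sum_abs_dtri_le: "(\<Sum>k\<in>{- int N..int N}. \<bar>dtri N k\<bar>) \<le> 2 * real N + 1"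
proof -
  have "(\<Sum>k\<in>{- int N..int N}. \<bar>dtri N k\<bar>) \<le> (\<Sum>k\<in>{- int N..int N}. 1)"
    by (intro sum_mono dtri_abs_le)
  then show ?thesis by simp
qed

lemma sum_dtri_square_le: "(\<Sum>k\<in>{- int N..int N}. (dtri N k)\<^sup>2) \<le> 2 * real N + 1"
proof -
  have "(\<Sum>k\<in>{- int N..int N}. (dtri N k)\<^sup>2) \<le> (\<Sum>k\<in>{- int N..int N}. 1)"
    using dtri_abs_le by (intro sum_mono) (simp add: abs_square_le_1)
  then show ?thesis by simp
qed

lemma sum_abs_tri_le: "(\<Sum>k\<in>{- int N..int N}. \<bar>tri N k\<bar>) \<le> (2 * real N + 1) * real N"
proof -
  have "(\<Sum>k\<in>{- int N..int N}. \<bar>tri N k\<bar>) \<le> (\<Sum>k\<in>{- int N..int N}. real N)"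
    by (intro sum_mono) (auto simp: tri_def)
  then show ?thesis by simp
qed

text \<open>The increasing half of the triangle alone contributes the squares of 1, ...,
  \<open>N\<close>. The order N^3 here, against the order N of the square sum of
  \<open>dtri\<close>, is the gain on which the density of the flow rests.\<close>

lemma sum_tri_square_ge: "real N ^ 3 / 3 \<le> (\<Sum>k\<in>{- int N..int N}. (tri N k)\<^sup>2)"
proof -
  have "real N ^ 3 / 3 \<le> (\<Sum>m\<in>{1..N}. (real m)\<^sup>2)"
    by (induction N) (auto simp: power2_eq_square power3_eq_cube algebra_simps)
  also have "\<dots> = (\<Sum>k\<in>{1 - int N..0}. (tri N k)\<^sup>2)"
    by (rule sum.reindex_bij_witness[of _ "\<lambda>k. nat (k + int N)" "\<lambda>m. int m - int N"])
      (auto simp: tri_def)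
  also have "\<dots> \<le> (\<Sum>k\<in>{- int N..int N}. (tri N k)\<^sup>2)"
    by (rule sum_mono2) auto
  finally show ?thesis .
qed

section \<open>Effective density of the linear flow\<close>

text \<open>By the hypothesis \<open>N\<close>, the mean of the sum of |E_j|^2 uses up at most half
  of \<open>\<eta>\<close> times the mean of |D|^2. The other half, multiplied by \<open>T\<close>,
  has to be covered by error terms of order 1/\<open>\<rho>\<close>, which caps \<open>T\<close>.
  The range in \<open>sep\<close> covers all frequency differences, since their coordinates are at
  most 2 N in absolute value.\<close>

lemma kronecker_time_bound:
  fixes x \<theta> :: "real ^ 'n"
  assumes "0 < \<rho>" "1 \<le> N" "0 < \<epsilon>" "0 \<le> T"
    and sep: "\<And>\<nu>. \<nu> \<in> int_lattice \<Longrightarrow> \<nu> \<noteq> 0 \<Longrightarrow> l1_norm \<nu> \<le> 2 * real CARD('n) * real N \<Longrightarrow>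
      \<rho> \<le> \<bar>x \<bullet> \<nu>\<bar>"
    and N: "18 * real CARD('n) \<le> (\<epsilon> / real CARD('n))\<^sup>2 * (real N)\<^sup>2"
    and T: "3 * 27 ^ CARD('n) * real N ^ CARD('n) / \<rho> < T"
  shows "\<exists>s\<in>{0..T}. \<exists>m\<in>int_lattice. l1_norm (s *\<^sub>R x - \<theta> - m) \<le> \<epsilon>"
proof (rule ccontr)
  assume "\<not> ?thesis"
  then have far: "\<And>s m. s \<in> {0..T} \<Longrightarrow> m \<in> int_lattice \<Longrightarrow> \<epsilon> < l1_norm (s *\<^sub>R x - \<theta> - m)"
    by force
  let ?n = "CARD('n)"
  let ?K = "{- int N..int N}"
  define \<eta> where "\<eta> = (\<epsilon> / real ?n)\<^sup>2"
  have "0 < \<eta>" using assms(3) by (simp add: \<eta>_def)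
  define D where "D s = (\<Prod>j\<in>UNIV. trig_poly (tri N) N (s * x $ j - \<theta> $ j))" for s
  \<comment> \<open>Replacing only the \<open>j\<close>-th coordinate's coefficients by
    \<open>dtri\<close> keeps \<open>E j\<close> a product over coordinates, so the same mean square
    estimate applies to it.\<close>
  define u where "u j i = (if i = j then dtri N else tri N)" for j i :: 'n
  define E where "E j s = (\<Prod>i\<in>UNIV. trig_poly (u j i) N (s * x $ i - \<theta> $ i))" for j s

  \<comment> \<open>The functional \<open>\<phi>\<close> is arbitrary because both the square sums
    and the absolute sums are needed.\<close>
  have prod_u: "(\<Prod>i\<in>UNIV. \<phi> (u j i)) = \<phi> (dtri N) * \<phi> (tri N) ^ (?n - 1)"
    for \<phi> :: "(int \<Rightarrow> real) \<Rightarrow> real" and j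
  proof -
    have "(\<Prod>i\<in>UNIV. \<phi> (u j i)) = \<phi> (u j j) * (\<Prod>i\<in>UNIV - {j}. \<phi> (u j i))"
      by (rule prod.remove) auto
    also have "(\<Prod>i\<in>UNIV - {j}. \<phi> (u j i)) = (\<Prod>i\<in>UNIV - {j}. \<phi> (tri N))"
      by (rule prod.cong) (auto simp: u_def)
    finally show ?thesis by (simp add: u_def)
  qed
  have E: "E j s = (1 - cis (2 * pi * (s * x $ j - \<theta> $ j))) * D s" for j s
  proof -
    have "E j s = trig_poly (u j j) N (s * x $ j - \<theta> $ j)
        * (\<Prod>i\<in>UNIV - {j}. trig_poly (u j i) N (s * x $ i - \<theta> $ i))"
      unfolding E_def by (rule prod.remove) auto
    also have "(\<Prod>i\<in>UNIV - {j}. trig_poly (u j i) N (s * x $ i - \<theta> $ i))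
        = (\<Prod>i\<in>UNIV - {j}. trig_poly (tri N) N (s * x $ i - \<theta> $ i))"
      by (rule prod.cong) (auto simp: u_def)
    also have "trig_poly (u j j) N (s * x $ j - \<theta> $ j)
        = (1 - cis (2 * pi * (s * x $ j - \<theta> $ j))) * trig_poly (tri N) N (s * x $ j - \<theta> $ j)"
      by (simp only: u_def refl if_True trig_poly_dtri)
    also have "\<dots> * (\<Prod>i\<in>UNIV - {j}. trig_poly (tri N) N (s * x $ i - \<theta> $ i))
        = (1 - cis (2 * pi * (s * x $ j - \<theta> $ j))) * (trig_poly (tri N) N (s * x $ j - \<theta> $ j)
          * (\<Prod>i\<in>UNIV - {j}. trig_poly (tri N) N (s * x $ i - \<theta> $ i)))"
      by (rule mult.assoc)
    also have "trig_poly (tri N) N (s * x $ j - \<theta> $ j)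
        * (\<Prod>i\<in>UNIV - {j}. trig_poly (tri N) N (s * x $ i - \<theta> $ i)) = D s"
      unfolding D_def by (rule prod.remove[symmetric]) auto
    finally show ?thesis .
  qed

  have pointwise: "\<eta> * (cmod (D s))\<^sup>2 \<le> (\<Sum>j\<in>UNIV. (cmod (E j s))\<^sup>2)" if "s \<in> {0..T}" for s
  proof -
    define y where "y j = s * x $ j - \<theta> $ j" for j
    \<comment> \<open>The nearest lattice point is still farther than \<open>\<epsilon>\<close>
      away, so some coordinate has distance more than \<open>\<epsilon>\<close> / n from the
      integers; the corresponding \<open>E j\<close> alone gives the bound.\<close>
    define m :: "real ^ 'n" where "m = (\<chi> j. of_int (round (y j)))"
    have "m \<in> int_lattice" by (simp add: m_def int_lattice_def)
    from far[OF that this] have *: "\<epsilon> < (\<Sum>j\<in>UNIV. \<bar>y j - of_int (round (y j))\<bar>)"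
      by (simp add: l1_norm_def m_def y_def)
    have "\<exists>j. \<epsilon> / real ?n < \<bar>y j - of_int (round (y j))\<bar>"
    proof (rule ccontr)
      assume "\<not> ?thesis"
      then have "(\<Sum>j\<in>UNIV. \<bar>y j - of_int (round (y j))\<bar>) \<le> (\<Sum>j\<in>(UNIV :: 'n set). \<epsilon> / real ?n)"
        by (intro sum_mono) (simp add: not_less)
      with * show False by simp
    qed
    then obtain j where j: "\<epsilon> / real ?n < \<bar>y j - of_int (round (y j))\<bar>" ..
    have "\<bar>y j - of_int (round (y j))\<bar> \<le> cmod (1 - cis (2 * pi * (y j - of_int (round (y j)))))"
      using of_int_round_abs_le[of "y j"] by (intro abs_le_norm_one_minus_cis) (simp add: abs_minus_commute)
    also have "cis (2 * pi * (y j - of_int (round (y j)))) = cis (2 * pi * y j)"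
      by (simp add: right_diff_distrib flip: cis_divide)
    finally have "\<epsilon> / real ?n \<le> cmod (1 - cis (2 * pi * y j))" using j by linarith
    then have "\<eta> \<le> (cmod (1 - cis (2 * pi * y j)))\<^sup>2"
      unfolding \<eta>_def using assms(3) by (intro power_mono) auto
    then have "\<eta> * (cmod (D s))\<^sup>2 \<le> (cmod (E j s))\<^sup>2"
      by (simp add: E y_def norm_mult power_mult_distrib mult_right_mono)
    also have "\<dots> \<le> (\<Sum>j\<in>UNIV. (cmod (E j s))\<^sup>2)"
      by (rule member_le_sum) auto
    finally show ?thesis .
  qed

  have D_int: "(\<lambda>s. (cmod (D s))\<^sup>2) integrable_on {0..T}"
    unfolding D_def by (intro integrable_continuous_real continuous_intros)
  have E_int: "(\<lambda>s. (cmod (E j s))\<^sup>2) integrable_on {0..T}" for j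
    unfolding E_def by (intro integrable_continuous_real continuous_intros)
  have "\<eta> * integral {0..T} (\<lambda>s. (cmod (D s))\<^sup>2) = integral {0..T} (\<lambda>s. \<eta> * (cmod (D s))\<^sup>2)"
    by simp
  also have "\<dots> \<le> integral {0..T} (\<lambda>s. \<Sum>j\<in>UNIV. (cmod (E j s))\<^sup>2)"
    by (rule integral_le)
      (use pointwise D_int E_int in \<open>auto intro!: integrable_sum integrable_on_mult_right\<close>)
  also have "\<dots> = (\<Sum>j\<in>UNIV. integral {0..T} (\<lambda>s. (cmod (E j s))\<^sup>2))"
    by (rule integral_sum) (use E_int in auto)
  finally have int_le: "\<eta> * integral {0..T} (\<lambda>s. (cmod (D s))\<^sup>2)
      \<le> (\<Sum>j\<in>UNIV. integral {0..T} (\<lambda>s. (cmod (E j s))\<^sup>2))" .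

  have sep': "\<rho> \<le> \<bar>x \<bullet> (\<chi> j. of_int (g j - h j))\<bar>"
    if gh: "g \<in> UNIV \<rightarrow> ?K" "h \<in> UNIV \<rightarrow> ?K" "g \<noteq> h" for g h :: "'n \<Rightarrow> int"
  proof (rule sep)
    show "(\<chi> j. real_of_int (g j - h j)) \<in> int_lattice" by (simp add: int_lattice_def)
    show "(\<chi> j. real_of_int (g j - h j)) \<noteq> 0"
      using gh(3) by (auto simp: vec_eq_iff fun_eq_iff)
    have "\<bar>real_of_int (g j - h j)\<bar> \<le> 2 * real N" for j
    proof -
      have "g j \<in> ?K" "h j \<in> ?K" using gh by auto
      then have "\<bar>g j - h j\<bar> \<le> 2 * int N" by auto
      then show ?thesis by linarith
    qed
    then have "l1_norm (\<chi> j. real_of_int (g j - h j)) \<le> (\<Sum>j\<in>(UNIV :: 'n set). 2 * real N)"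
      unfolding l1_norm_def by (intro sum_mono) simp
    then show "l1_norm (\<chi> j. real_of_int (g j - h j)) \<le> 2 * real ?n * real N" by simp
  qed
  \<comment> \<open>The bounds used below are B >= N^3/3, B' <= 3 N, S <= 3 N^2 and S' <= 3
    N.\<close>
  define B where "B = (\<Sum>k\<in>?K. (tri N k)\<^sup>2)"
  define B' where "B' = (\<Sum>k\<in>?K. (dtri N k)\<^sup>2)"
  define S where "S = (\<Sum>k\<in>?K. \<bar>tri N k\<bar>)"
  define S' where "S' = (\<Sum>k\<in>?K. \<bar>dtri N k\<bar>)"
  have mean_square:
    "\<bar>integral {0..T} (\<lambda>s. (cmod (\<Prod>i\<in>UNIV. trig_poly (v i) N (s * x $ i - \<theta> $ i)))\<^sup>2)
      - T * (\<Prod>i\<in>UNIV. \<Sum>k\<in>?K. (v i k)\<^sup>2)\<bar> \<le> (\<Prod>i\<in>UNIV. \<Sum>k\<in>?K. \<bar>v i k\<bar>)\<^sup>2 / \<rho>"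
    for v :: "'n \<Rightarrow> int \<Rightarrow> real"
    by (rule mean_square_prod_trig_poly[OF finite_atLeastAtMost_int assms(4,1)]) (rule sep')
  have "\<bar>integral {0..T} (\<lambda>s. (cmod (D s))\<^sup>2) - T * B ^ ?n\<bar> \<le> (S ^ ?n)\<^sup>2 / \<rho>"
    using mean_square[where v = "\<lambda>_. tri N"]
    unfolding D_def B_def S_def by (simp only: prod_constant)
  then have D_ge: "T * B ^ ?n - (S ^ ?n)\<^sup>2 / \<rho> \<le> integral {0..T} (\<lambda>s. (cmod (D s))\<^sup>2)"
    by linarith
  have E_le: "integral {0..T} (\<lambda>s. (cmod (E j s))\<^sup>2)
      \<le> T * (B' * B ^ (?n - 1)) + (S' * S ^ (?n - 1))\<^sup>2 / \<rho>" for j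
    using mean_square[where v = "u j"]
    unfolding E_def B_def S_def B'_def S'_def
      prod_u[where j = j and \<phi> = "\<lambda>v. \<Sum>k\<in>?K. (v k)\<^sup>2"]
      prod_u[where j = j and \<phi> = "\<lambda>v. \<Sum>k\<in>?K. \<bar>v k\<bar>"]
    by linarith
  obtain p where p: "?n = Suc p" using zero_less_card_finite[where 'a = 'n] gr0_conv_Suc by blast
  define n where "n = real ?n"
  have "1 \<le> n" by (simp add: n_def p)
  have "\<eta> * (T * B ^ ?n - (S ^ ?n)\<^sup>2 / \<rho>) \<le> \<eta> * integral {0..T} (\<lambda>s. (cmod (D s))\<^sup>2)"
    using D_ge \<open>0 < \<eta>\<close> by (intro mult_left_mono) auto
  also note int_le
  also have "(\<Sum>j\<in>UNIV. integral {0..T} (\<lambda>s. (cmod (E j s))\<^sup>2))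
      \<le> (\<Sum>j\<in>(UNIV :: 'n set). T * (B' * B ^ (?n - 1)) + (S' * S ^ (?n - 1))\<^sup>2 / \<rho>)"
    by (intro sum_mono E_le)
  finally have "\<eta> * (T * B ^ ?n - (S ^ ?n)\<^sup>2 / \<rho>) \<le> n * (T * (B' * B ^ p) + (S' * S ^ p)\<^sup>2 / \<rho>)"
    by (simp add: n_def p)
  \<comment> \<open>The terms proportional to \<open>T\<close> are collected on the left and the
    errors on the right; \<open>p\<close> is n - 1, so one factor \<open>B\<close> is split
    off.\<close>
  then have main: "T * B ^ p * (\<eta> * B - n * B') \<le> (S ^ p)\<^sup>2 * (\<eta> * S\<^sup>2 + n * S'\<^sup>2) / \<rho>"
    by (simp add: p n_def algebra_simps add_divide_distrib power_mult_distrib)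

  have factor: "(Y ^ p)\<^sup>2 * (\<eta> * Y\<^sup>2 * (3 / 2)) / \<rho> = \<eta> / 2 * (3 * (Y ^ ?n)\<^sup>2 / \<rho>)" for Y
    by (simp add: p power_mult_distrib)
  have factor': "3 * (27 * real N * Y) ^ ?n / \<rho> = 3 * 27 ^ ?n * real N ^ ?n / \<rho> * Y ^ ?n" for Y
    by (simp add: power_mult_distrib)
  have N1: "1 \<le> real N" using assms(2) by simp
  have B: "real N ^ 3 / 3 \<le> B" unfolding B_def by (rule sum_tri_square_ge)
  have B': "B' \<le> 3 * real N" using sum_dtri_square_le[of N] N1 unfolding B'_def by linarith
  have S': "S' \<le> 3 * real N" using sum_abs_dtri_le[of N] N1 unfolding S'_def by linarith
  have "0 \<le> S" "0 \<le> S'" unfolding S_def S'_def by (auto intro: sum_nonneg)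
  have "(2 * real N + 1) * real N \<le> (3 * real N) * real N"
    by (rule mult_right_mono) (use N1 in auto)
  then have S: "S \<le> 3 * (real N)\<^sup>2"
    using sum_abs_tri_le[of N] unfolding S_def by (simp add: power2_eq_square)
  have N': "18 * n \<le> \<eta> * (real N)\<^sup>2" using N by (simp add: \<eta>_def n_def)
  have "0 < B" using B N1 by (smt (verit) divide_pos_pos zero_less_power)
  \<comment> \<open>The constant 18 in the hypothesis on \<open>N\<close> is chosen here: 3 n N = 18
    n N / 6, which is at most half of \<open>\<eta>\<close> N^3/3.\<close>
  have "n * B' \<le> n * (3 * real N)" using B' \<open>1 \<le> n\<close> by (intro mult_left_mono) auto
  also have "\<dots> \<le> \<eta> * (real N)\<^sup>2 / 6 * real N"
    using mult_right_mono[OF N', of "real N"] by simp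
  also have "\<dots> = \<eta> / 2 * (real N ^ 3 / 3)" by (simp add: power2_eq_square power3_eq_cube)
  also have "\<dots> \<le> \<eta> / 2 * B" using B \<open>0 < \<eta>\<close> by (intro mult_left_mono) auto
  finally have "\<eta> / 2 * B \<le> \<eta> * B - n * B'" by linarith
  then have "T * B ^ p * (\<eta> / 2 * B) \<le> T * B ^ p * (\<eta> * B - n * B')"
    using assms(4) \<open>0 < B\<close> by (intro mult_left_mono) auto
  also note main
  also have "(S ^ p)\<^sup>2 * (\<eta> * S\<^sup>2 + n * S'\<^sup>2) / \<rho>
      \<le> ((3 * (real N)\<^sup>2) ^ p)\<^sup>2 * (\<eta> * (3 * (real N)\<^sup>2)\<^sup>2 * (3 / 2)) / \<rho>"
  proof (intro divide_right_mono mult_mono power_mono)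
    \<comment> \<open>The errors from the \<open>E j\<close> are at most half of the bound for the
      error from \<open>D\<close>, whence the factor 3/2.\<close>
    have "n * S'\<^sup>2 \<le> n * (3 * real N)\<^sup>2"
      using S' \<open>0 \<le> S'\<close> \<open>1 \<le> n\<close> by (intro mult_left_mono power_mono) auto
    also have "\<dots> = 18 * n * ((real N)\<^sup>2 / 2)" by (simp add: power2_eq_square)
    also have "\<dots> \<le> \<eta> * (real N)\<^sup>2 * ((real N)\<^sup>2 / 2)"
      by (intro mult_right_mono N') auto
    also have "\<dots> \<le> 9 * (\<eta> * (real N)\<^sup>2 * ((real N)\<^sup>2 / 2))"
      using \<open>0 < \<eta>\<close> by simp
    also have "\<dots> = \<eta> * (3 * (real N)\<^sup>2)\<^sup>2 / 2"
      by (simp add: power2_eq_square)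
    finally have "n * S'\<^sup>2 \<le> \<eta> * (3 * (real N)\<^sup>2)\<^sup>2 / 2" .
    moreover have "\<eta> * S\<^sup>2 \<le> \<eta> * (3 * (real N)\<^sup>2)\<^sup>2"
      using \<open>0 < \<eta>\<close> \<open>0 \<le> S\<close> S by (intro mult_left_mono power_mono) auto
    ultimately show "\<eta> * S\<^sup>2 + n * S'\<^sup>2 \<le> \<eta> * (3 * (real N)\<^sup>2)\<^sup>2 * (3 / 2)" by linarith
  qed (use S \<open>0 \<le> S\<close> \<open>0 < \<eta>\<close> \<open>1 \<le> n\<close> assms(1) in auto)
  also have "\<dots> = \<eta> / 2 * (3 * ((3 * (real N)\<^sup>2) ^ ?n)\<^sup>2 / \<rho>)"
    by (rule factor)
  finally have "\<eta> / 2 * (T * B ^ ?n) \<le> \<eta> / 2 * (3 * ((3 * (real N)\<^sup>2) ^ ?n)\<^sup>2 / \<rho>)"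
    by (simp add: p mult_ac)
  then have "T * B ^ ?n \<le> 3 * ((3 * (real N)\<^sup>2) ^ ?n)\<^sup>2 / \<rho>"
    using \<open>0 < \<eta>\<close> by (subst (asm) mult_le_cancel_left_pos) auto
  moreover have "T * (real N ^ 3 / 3) ^ ?n \<le> T * B ^ ?n"
    using assms(4) B by (intro mult_left_mono power_mono) auto
  ultimately have "T * (real N ^ 3 / 3) ^ ?n \<le> 3 * ((3 * (real N)\<^sup>2) ^ ?n)\<^sup>2 / \<rho>" by linarith
  also have "((3 * (real N)\<^sup>2) ^ ?n)\<^sup>2 = ((3 * (real N)\<^sup>2)\<^sup>2) ^ ?n"
    by (simp only: power2_eq_square power_mult_distrib)
  \<comment> \<open>Extracting N^3/3 lets its n-th power cancel against the lower bound for B^n. The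
    remaining 27 N per coordinate explains the threshold in \<open>T\<close>.\<close>
  also have "(3 * (real N)\<^sup>2)\<^sup>2 = 27 * real N * (real N ^ 3 / 3)"
    by (simp add: power2_eq_square power3_eq_cube)
  also have "3 * (27 * real N * (real N ^ 3 / 3)) ^ ?n / \<rho>
      = 3 * 27 ^ ?n * real N ^ ?n / \<rho> * (real N ^ 3 / 3) ^ ?n"
    by (rule factor')
  finally have "T * (real N ^ 3 / 3) ^ ?n
      \<le> 3 * 27 ^ ?n * real N ^ ?n / \<rho> * (real N ^ 3 / 3) ^ ?n" .
  moreover have "0 < (real N ^ 3 / 3) ^ ?n" using N1 by simp
  ultimately have "T \<le> 3 * 27 ^ ?n * real N ^ ?n / \<rho>"
    by (simp only: mult_le_cancel_right_pos)
  with T show False by linarith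
qed

lemma l1_norm_pos: "x \<noteq> 0 \<Longrightarrow> 0 < l1_norm x"
proof -
  assume "x \<noteq> 0"
  then obtain i where "x $ i \<noteq> 0" by (auto simp: vec_eq_iff)
  then show "0 < l1_norm x"
    unfolding l1_norm_def by (intro sum_pos2[where i = i]) auto
qed

lemma circle_norm_le_abs: "circle_norm z \<le> \<bar>z\<bar>"
proof -
  have "circle_norm z \<le> \<bar>z - of_int 0\<bar>"
    unfolding circle_norm_def by (rule cINF_lower) (auto intro!: bdd_belowI[where m = 0])
  then show ?thesis by simp
qed

text \<open>With \<open>N\<close> of order 1/\<open>\<epsilon>\<close>, bad approximability gives a
  separation \<open>\<rho>\<close> of order N^(-q). The time N^n / \<open>\<rho>\<close> is then of
  order N^(n + q).\<close>

lemma effective_kronecker: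
  fixes x :: "real ^ 'n"
  assumes "0 < c" "badly_approximable c q x"
  obtains C where "0 < C"
    "\<And>\<epsilon> \<theta>. 0 < \<epsilon> \<Longrightarrow> \<epsilon> \<le> real CARD('n) \<Longrightarrow>
      \<exists>s\<in>{0..C / \<epsilon> ^ (CARD('n) + q)}. \<exists>m\<in>int_lattice. l1_norm (s *\<^sub>R x - \<theta> - m) \<le> \<epsilon>"
proof -
  define n where "n = real CARD('n)"
  have "1 \<le> n" by (simp add: n_def Suc_leI)
  let ?d = "CARD('n)"
  \<comment> \<open>The 4 exceeds the 3 of the time bound so that the required inequality is strict;
    \<open>6 * n\<^sup>2\<close> comes from the upper bound for \<open>N\<close>.\<close>
  define C where "C = 4 * 27 ^ ?d * (2 * n) ^ q / c * (6 * n\<^sup>2) ^ (?d + q)"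
  have "0 < C" using assms(1) \<open>1 \<le> n\<close> by (simp add: C_def)
  moreover have "\<exists>s\<in>{0..C / \<epsilon> ^ (?d + q)}. \<exists>m\<in>int_lattice. l1_norm (s *\<^sub>R x - \<theta> - m) \<le> \<epsilon>"
    if \<epsilon>: "0 < \<epsilon>" "\<epsilon> \<le> n" for \<epsilon> \<theta>
  proof -
    \<comment> \<open>The factor 5 works because 25 n^2 >= 18 n. Rounding up costs at most 1, which
      \<open>\<epsilon>\<close> <= n bounds by n^2 / \<open>\<epsilon>\<close>.\<close>
    define N where "N = nat \<lceil>5 * n\<^sup>2 / \<epsilon>\<rceil>"
    have "n * 1 \<le> n * n" using \<open>1 \<le> n\<close> by (intro mult_left_mono) auto
    with \<epsilon> have "\<epsilon> \<le> n * n" by linarith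
    with \<epsilon> have "1 \<le> n\<^sup>2 / \<epsilon>"
      by (simp add: power2_eq_square)
    have N: "5 * n\<^sup>2 / \<epsilon> \<le> real N" by (simp add: N_def real_nat_ceiling_ge)
    have "real N \<le> 5 * n\<^sup>2 / \<epsilon> + 1"
      using \<epsilon> of_int_ceiling_le_add_one[of "5 * n\<^sup>2 / \<epsilon>"] by (simp add: N_def)
    with \<open>1 \<le> n\<^sup>2 / \<epsilon>\<close> have N_le: "real N \<le> 6 * n\<^sup>2 / \<epsilon>" by simp
    have N1: "1 \<le> real N" using N \<open>1 \<le> n\<^sup>2 / \<epsilon>\<close> by simp
    define \<rho> where "\<rho> = c / (2 * n * real N) ^ q"
    have "0 < \<rho>" using assms(1) \<open>1 \<le> n\<close> N1 by (simp add: \<rho>_def)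
    have "3 * 27 ^ ?d * real N ^ ?d / \<rho> = 3 * 27 ^ ?d * (2 * n) ^ q / c * real N ^ (?d + q)"
      by (simp add: \<rho>_def power_add power_mult_distrib)
    also have "\<dots> \<le> 3 * 27 ^ ?d * (2 * n) ^ q / c * (6 * n\<^sup>2 / \<epsilon>) ^ (?d + q)"
      using assms(1) \<open>1 \<le> n\<close> N_le by (intro mult_left_mono power_mono) auto
    also have "\<dots> < 4 * 27 ^ ?d * (2 * n) ^ q / c * (6 * n\<^sup>2 / \<epsilon>) ^ (?d + q)"
      using assms(1) \<open>1 \<le> n\<close> \<epsilon> by (intro mult_strict_right_mono divide_strict_right_mono) auto
    also have "\<dots> = C / \<epsilon> ^ (?d + q)"
      by (simp add: C_def power_divide)
    finally have T: "3 * 27 ^ ?d * real N ^ ?d / \<rho> < C / \<epsilon> ^ (?d + q)" .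
    show ?thesis
    proof (rule kronecker_time_bound[OF \<open>0 < \<rho>\<close> _ \<epsilon>(1) _ _ _ T])
      show "1 \<le> N" using N1 by simp
      show "0 \<le> C / \<epsilon> ^ (?d + q)" using \<open>0 < C\<close> \<epsilon> by simp
      have "18 * n \<le> 25 * n\<^sup>2" using \<open>1 \<le> n\<close> by (simp add: power2_eq_square)
      also have "\<dots> = (\<epsilon> / n)\<^sup>2 * (5 * n\<^sup>2 / \<epsilon>)\<^sup>2"
        using \<epsilon> \<open>1 \<le> n\<close> by (simp add: power2_eq_square field_simps)
      also have "\<dots> \<le> (\<epsilon> / n)\<^sup>2 * (real N)\<^sup>2"
        using N \<epsilon> by (intro mult_left_mono power_mono) auto
      finally show "18 * real ?d \<le> (\<epsilon> / real ?d)\<^sup>2 * (real N)\<^sup>2" by (simp add: n_def)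
    next
      fix \<nu> :: "real ^ 'n"
      assume \<nu>: "\<nu> \<in> int_lattice" "\<nu> \<noteq> 0" "l1_norm \<nu> \<le> 2 * real ?d * real N"
      have "\<rho> \<le> c / l1_norm \<nu> ^ q"
        unfolding \<rho>_def n_def using assms(1) \<nu> l1_norm_pos[OF \<nu>(2)] N1
        by (intro divide_left_mono power_mono mult_pos_pos) auto
      also have "\<dots> \<le> circle_norm (x \<bullet> \<nu>)"
        using assms(2) \<nu>(1,2) unfolding badly_approximable_def by (simp add: less_imp_le)
      also have "\<dots> \<le> \<bar>x \<bullet> \<nu>\<bar>" by (rule circle_norm_le_abs)
      finally show "\<rho> \<le> \<bar>x \<bullet> \<nu>\<bar>" .
    qed
  qed
  ultimately show ?thesis using that unfolding n_def by blast
qed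

section \<open>Second-order expansion of the curve at 0\<close>

text \<open>Differentiability of \<open>f'\<close> at 0 bounds its increment by a multiple of t, and
  the mean value inequality on [0, t] turns this into a quadratic error for
  \<open>f\<close>.\<close>

lemma twice_cont_diff_at_0_expansion:
  fixes f :: "real \<Rightarrow> real ^ 'n"
  assumes "twice_cont_diff_at_0 f" "f 0 = 0"
  obtains r K where "0 < r" "r \<le> 1" "0 < K"
    "\<And>t. 0 \<le> t \<Longrightarrow> t \<le> r \<Longrightarrow>
      l1_norm (f t - t *\<^sub>R vector_derivative f (at 0 within {0..1})) \<le> K * t\<^sup>2"
proof -
  obtain \<delta> f' f'' where \<delta>: "0 < \<delta>" "\<delta> \<le> 1"
    and f': "\<And>t. t \<in> {0..<\<delta>} \<Longrightarrow> (f has_vector_derivative f' t) (at t within {0..<\<delta>})"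
    and f'': "\<And>t. t \<in> {0..<\<delta>} \<Longrightarrow> (f' has_vector_derivative f'' t) (at t within {0..<\<delta>})"
    using assms(1) unfolding twice_cont_diff_at_0_def by blast
  \<comment> \<open>Both one-sided neighbourhoods agree near 0, so the derivative within [0, 1] is
    the one supplied by the smoothness assumption.\<close>
  have "at 0 within {0..1} = at 0 within {0..<\<delta>}"
    by (rule at_within_nhd[where S = "{-\<delta><..<\<delta>}"]) (use \<delta> in auto)
  then have x: "vector_derivative f (at 0 within {0..1}) = f' 0"
    using f'[of 0] \<delta> by (intro vector_derivative_within_closed_interval) auto
  have "(f' has_derivative (\<lambda>h. h *\<^sub>R f'' 0)) (at 0 within {0..<\<delta>})"
    using f''[of 0] \<delta> by (simp add: has_vector_derivative_def)
  then obtain d where d: "0 < d"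
    "\<And>t. t \<in> {0..<\<delta>} \<Longrightarrow> norm (t - 0) < d \<Longrightarrow>
      norm (f' t - f' 0 - (t - 0) *\<^sub>R f'' 0) \<le> 1 * norm (t - 0)"
    unfolding has_derivative_within_alt by (metis zero_less_one)
  define r where "r = min \<delta> d / 2"
  have r: "0 < r" "r \<le> 1" "r < \<delta>" "r < d" using \<delta> d(1) by (auto simp: r_def)
  define K where "K = 1 + norm (f'' 0)"
  have "0 < K" by (simp add: K_def add_pos_nonneg)
  have f'_bound: "norm (f' t - f' 0) \<le> K * t" if "0 \<le> t" "t \<le> r" for t
  proof -
    have "norm (f' t - f' 0) \<le> norm (f' t - f' 0 - t *\<^sub>R f'' 0) + norm (t *\<^sub>R f'' 0)"
      by (metis norm_triangle_sub add.commute)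
    also have "\<dots> \<le> t + t * norm (f'' 0)"
      using d(2)[of t] that r by simp
    finally show ?thesis by (simp add: K_def algebra_simps)
  qed
  have expansion: "norm (f t - t *\<^sub>R f' 0) \<le> K * t\<^sup>2" if t: "0 \<le> t" "t \<le> r" for t
  proof -
    have "norm (f t - f 0 - (t - 0) *\<^sub>R f' 0) \<le> norm (t - 0) * (K * t)"
    proof (rule vector_differentiable_bound_linearization[where S = "{0..t}"])
      fix u assume u: "u \<in> {0..t}"
      show "(f has_vector_derivative f' u) (at u within {0..t})"
        by (rule has_vector_derivative_within_subset[OF f']) (use u t r in auto)
      have "norm (f' u - f' 0) \<le> K * u" using u t by (intro f'_bound) auto
      also have "\<dots> \<le> K * t" using u \<open>0 < K\<close> by (intro mult_left_mono) auto
      finally show "norm (f' u - f' 0) \<le> K * t" .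
    qed (use t in \<open>auto simp: closed_segment_eq_real_ivl\<close>)
    then show ?thesis using assms(2) t by (simp add: power2_eq_square mult_ac)
  qed
  \<comment> \<open>The factor n pays for passing from the Euclidean norm to the l1 norm.\<close>
  have "l1_norm (f t - t *\<^sub>R f' 0) \<le> real CARD('n) * K * t\<^sup>2" if "0 \<le> t" "t \<le> r" for t
  proof -
    have "l1_norm (f t - t *\<^sub>R f' 0) \<le> (\<Sum>i\<in>(UNIV :: 'n set). norm (f t - t *\<^sub>R f' 0))"
      unfolding l1_norm_def by (intro sum_mono component_le_norm_cart)
    also have "\<dots> \<le> real CARD('n) * (K * t\<^sup>2)"
      using expansion[OF that] by (simp add: mult_left_mono)
    finally show ?thesis by simp
  qed
  with that[of r "real CARD('n) * K"] r \<open>0 < K\<close> show ?thesis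
    by (simp add: x)
qed

section \<open>From representatives to distances on the torus\<close>

lemma l1_norm_triangle_ineq: "l1_norm (x + y) \<le> l1_norm x + l1_norm y"
  unfolding l1_norm_def by (simp add: abs_triangle_ineq sum_mono flip: sum.distrib)

lemma l1_norm_scaleR: "l1_norm (a *\<^sub>R x) = \<bar>a\<bar> * l1_norm x"
  by (simp add: l1_norm_def abs_mult sum_distrib_left)

lemma torus_dist_le:
  fixes y \<theta> m :: "real ^ 'n"
  assumes "m \<in> int_lattice"
  shows "torus_dist (torus_proj \<theta>) (torus_proj y) \<le> l1_norm (y - \<theta> - m)"
proof -
  have "(\<theta> + m, y) \<in> torus_proj \<theta> \<times> torus_proj y"
    using assms by (auto simp: torus_proj_def lattice_rel_def int_lattice_def)
  then have "torus_dist (torus_proj \<theta>) (torus_proj y) \<le> (case (\<theta> + m, y) of (a, b) \<Rightarrow> l1_norm (a - b))"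
    unfolding torus_dist_def
    by (rule cINF_lower[rotated]) (auto intro!: bdd_belowI[where m = 0] simp: l1_norm_def sum_nonneg)
  also have "\<dots> = l1_norm (y - \<theta> - m)"
    by (simp add: l1_norm_def abs_minus_commute algebra_simps)
  finally show ?thesis .
qed

lemma eps_dense_torus_projI:
  assumes "\<And>\<theta>. \<exists>y\<in>S. \<exists>m\<in>int_lattice. l1_norm (y - \<theta> - m) \<le> \<epsilon>"
  shows "eps_dense \<epsilon> (torus_proj ` S)"
  unfolding eps_dense_def
proof (intro conjI ballI)
  show "torus_proj ` S \<subseteq> torus"
    by (auto simp: torus_def torus_proj_def quotient_def)
  fix P :: "(real ^ 'a) set" assume "P \<in> torus"
  then obtain \<theta> where "P = torus_proj \<theta>"
    by (auto simp: torus_def torus_proj_def quotient_def)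
  then show "\<exists>Q\<in>torus_proj ` S. torus_dist P Q \<le> \<epsilon>"
    using assms[of \<theta>] torus_dist_le order_trans by blast
qed

section \<open>Comparison of exponents and conclusion\<close>

text \<open>Since n (n + 1) is at least 2 and at least 2 n, the product
  \<open>(q + 1) * n * (n + 1)\<close> is at least 2 n + 2 q. The left side is the exponent of
  1/\<open>\<epsilon>\<close> in T^2 / \<open>\<epsilon>\<close> when \<open>T\<close> has order
  \<open>\<epsilon>\<close> to the power -(n + q).\<close>

lemma density_exponent_ge:
  assumes "1 \<le> n"
  shows "2 * (n + q) + 1 \<le> density_exponent n q"
proof -
  obtain p where "n = Suc p" using assms by (cases n) auto
  then have "2 * (n + q) \<le> (q + 1) * n * (n + 1)"
    by (simp add: algebra_simps)
  then show ?thesis by (simp add: density_exponent_def)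
qed

theorem theorem8:
  fixes f :: "real \<Rightarrow> real ^ 'n" and c :: real and q :: nat
  assumes "c > 0"
    and "path f"
    and "f 0 = 0"
    and "twice_cont_diff_at_0 f"
    and "badly_approximable c q (vector_derivative f (at 0 within {0..1}))"
  shows "\<exists>C>0. \<forall>\<epsilon>>0. \<forall>L \<ge> C * \<epsilon> powr (- real (density_exponent CARD('n) q)).
           eps_dense \<epsilon> (torus_proj ` (\<lambda>t. L *\<^sub>R f t) ` {0..1})"
proof -
  define x where "x = vector_derivative f (at 0 within {0..1})"
  define n where "n = real CARD('n)"
  have "1 \<le> n" by (simp add: n_def Suc_leI)
  let ?d = "CARD('n)"
  let ?e = "density_exponent CARD('n) q"
  obtain r K where r: "0 < r" "r \<le> 1" and "0 < K"
    and K: "\<And>t. 0 \<le> t \<Longrightarrow> t \<le> r \<Longrightarrow> l1_norm (f t - t *\<^sub>R x) \<le> K * t\<^sup>2"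
    using twice_cont_diff_at_0_expansion[OF assms(4,3)] unfolding x_def by blast
  obtain C0 where "0 < C0" and C0: "\<And>\<epsilon> \<theta>. 0 < \<epsilon> \<Longrightarrow> \<epsilon> \<le> n \<Longrightarrow>
      \<exists>s\<in>{0..C0 / \<epsilon> ^ (?d + q)}. \<exists>m\<in>int_lattice. l1_norm (s *\<^sub>R x - \<theta> - m) \<le> \<epsilon>"
    using effective_kronecker[OF assms(1,5)] unfolding x_def n_def by blast
  \<comment> \<open>Chosen so that the flow time for precision \<open>\<epsilon> / 2\<close> is
    \<open>C1 / a ^ (?d + q)\<close> with \<open>a = \<epsilon> / n\<close>.\<close>
  define C1 where "C1 = C0 * 2 ^ (?d + q) / n ^ (?d + q)"
  have "0 < C1" using \<open>0 < C0\<close> \<open>1 \<le> n\<close> by (simp add: C1_def)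
  \<comment> \<open>The summand \<open>C1 / r\<close> keeps the parameter s / L inside [0, r]; the
    other one makes the deviation from the flow at most \<open>\<epsilon> / 2\<close>. The power of
    \<open>n\<close> converts \<open>\<epsilon>\<close> into \<open>a\<close>.\<close>
  define C where "C = n ^ ?e * (C1 / r + 2 * K * C1\<^sup>2 / n)"
  have "0 < C" using \<open>0 < C1\<close> \<open>1 \<le> n\<close> r \<open>0 < K\<close> by (simp add: C_def add_pos_pos)
  moreover have "eps_dense \<epsilon> (torus_proj ` (\<lambda>t. L *\<^sub>R f t) ` {0..1})"
    if "0 < \<epsilon>" and L: "C * \<epsilon> powr (- real ?e) \<le> L" for \<epsilon> L
  proof (rule eps_dense_torus_projI)
    fix \<theta> :: "real ^ 'n"
    show "\<exists>y\<in>(\<lambda>t. L *\<^sub>R f t) ` {0..1}. \<exists>m\<in>int_lattice. l1_norm (y - \<theta> - m) \<le> \<epsilon>"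
    proof (cases "\<epsilon> \<le> n")
      case False
      \<comment> \<open>For \<open>\<epsilon>\<close> > n a single point of the curve suffices:
        modulo the lattice each coordinate can be moved into [0, 1].\<close>
      define m :: "real ^ 'n" where "m = (\<chi> j. of_int \<lfloor>(L *\<^sub>R f 0 - \<theta>) $ j\<rfloor>)"
      have "l1_norm (L *\<^sub>R f 0 - \<theta> - m) \<le> (\<Sum>j\<in>(UNIV :: 'n set). 1)"
        unfolding l1_norm_def
      proof (rule sum_mono)
        fix j
        show "\<bar>(L *\<^sub>R f 0 - \<theta> - m) $ j\<bar> \<le> 1"
          using floor_correct[of "(L *\<^sub>R f 0 - \<theta>) $ j"]
          by (simp only: m_def vector_minus_component vec_lambda_beta) linarith
      qed
      with False have "l1_norm (L *\<^sub>R f 0 - \<theta> - m) \<le> \<epsilon>" by (simp add: n_def)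
      moreover have "m \<in> int_lattice" by (simp add: m_def int_lattice_def)
      ultimately show ?thesis by force
    next
      case True
      \<comment> \<open>Normalising by \<open>n\<close> gives \<open>a\<close> <= 1, so a larger
        exponent makes 1 / a^k larger.\<close>
      define a where "a = \<epsilon> / n"
      have a: "0 < a" "a \<le> 1" and \<epsilon>: "\<epsilon> = n * a"
        using \<open>0 < \<epsilon>\<close> True \<open>1 \<le> n\<close> by (auto simp: a_def)
      define T where "T = C1 / a ^ (?d + q)"
      have "0 < T" using \<open>0 < C1\<close> a by (simp add: T_def)
      have "C0 / (\<epsilon> / 2) ^ (?d + q) = T"
        using \<open>1 \<le> n\<close> by (simp add: T_def C1_def \<epsilon> power_divide power_mult_distrib)
      with C0[of "\<epsilon> / 2" \<theta>] obtain s m where s: "0 \<le> s" "s \<le> T" and m: "m \<in> int_lattice"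
        and close: "l1_norm (s *\<^sub>R x - \<theta> - m) \<le> \<epsilon> / 2"
        using \<open>0 < \<epsilon>\<close> True by auto
      let ?M = "2 * (?d + q) + 1"
      have C_eq: "C * \<epsilon> powr (- real ?e) = (C1 / r + 2 * K * C1\<^sup>2 / n) * (1 / a ^ ?e)"
        using \<open>0 < \<epsilon>\<close> \<open>1 \<le> n\<close> a
        by (simp add: C_def \<epsilon> powr_minus powr_realpow power_mult_distrib divide_inverse)
      have "1 / a ^ ?M \<le> 1 / a ^ ?e"
        using density_exponent_ge[of ?d q] a
        by (intro divide_left_mono power_decreasing) (auto simp: Suc_leI)
      moreover have "0 \<le> C1 / r + 2 * K * C1\<^sup>2 / n"
        using \<open>0 < C1\<close> r \<open>0 < K\<close> \<open>1 \<le> n\<close> by simp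
      ultimately have "(C1 / r + 2 * K * C1\<^sup>2 / n) * (1 / a ^ ?M)
          \<le> (C1 / r + 2 * K * C1\<^sup>2 / n) * (1 / a ^ ?e)"
        by (rule mult_left_mono)
      with L C_eq have L': "(C1 / r + 2 * K * C1\<^sup>2 / n) * (1 / a ^ ?M) \<le> L" by linarith
      have "T / r = C1 / r * (1 / a ^ (?d + q))" by (simp add: T_def)
      also have "\<dots> \<le> C1 / r * (1 / a ^ ?M)"
        using a \<open>0 < C1\<close> r by (intro mult_left_mono divide_left_mono power_decreasing) auto
      also have "\<dots> \<le> (C1 / r + 2 * K * C1\<^sup>2 / n) * (1 / a ^ ?M)"
        using a \<open>0 < C1\<close> \<open>0 < K\<close> \<open>1 \<le> n\<close> by (intro mult_right_mono) auto
      also note L'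
      finally have "T \<le> L * r" using r by (simp add: field_simps)
      with \<open>0 < T\<close> r have "0 < L" by (smt (verit) mult_nonneg_nonneg zero_less_mult_iff)
      have "a ^ ?M = (a ^ (?d + q))\<^sup>2 * a"
        by (metis Suc_eq_plus1 power_Suc2 power_even_eq)
      then have "2 * K * T\<^sup>2 / \<epsilon> = 2 * K * C1\<^sup>2 / n * (1 / a ^ ?M)"
        unfolding T_def \<epsilon> by (simp only: power_divide) simp
      also have "\<dots> \<le> (C1 / r + 2 * K * C1\<^sup>2 / n) * (1 / a ^ ?M)"
        using a \<open>0 < C1\<close> r by (intro mult_right_mono) auto
      also note L'
      finally have err: "K * T\<^sup>2 / L \<le> \<epsilon> / 2"
        using \<open>0 < L\<close> \<open>0 < \<epsilon>\<close> by (simp add: field_simps)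
      define t where "t = s / L"
      have t: "0 \<le> t" "t \<le> r" "s = L * t"
        using s \<open>T \<le> L * r\<close> \<open>0 < L\<close> by (auto simp: t_def field_simps)
      \<comment> \<open>Half of \<open>\<epsilon>\<close> is spent on the distance of the flow from
        the target, half on the distance of the curve from the flow at time s = L t.\<close>
      have "l1_norm (L *\<^sub>R f t - \<theta> - m) = l1_norm (L *\<^sub>R (f t - t *\<^sub>R x) + (s *\<^sub>R x - \<theta> - m))"
        by (simp add: t(3) algebra_simps)
      also have "\<dots> \<le> L * l1_norm (f t - t *\<^sub>R x) + l1_norm (s *\<^sub>R x - \<theta> - m)"
        using l1_norm_triangle_ineq[of "L *\<^sub>R (f t - t *\<^sub>R x)"] \<open>0 < L\<close>
        by (simp add: l1_norm_scaleR)
      also have "\<dots> \<le> L * (K * t\<^sup>2) + \<epsilon> / 2"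
        using K[OF t(1,2)] close \<open>0 < L\<close> by (intro add_mono mult_left_mono) auto
      also have "L * (K * t\<^sup>2) = K * s\<^sup>2 / L"
        using \<open>0 < L\<close> by (simp add: t_def power2_eq_square)
      also have "K * s\<^sup>2 / L \<le> K * T\<^sup>2 / L"
        using s \<open>0 < K\<close> \<open>0 < L\<close> by (intro divide_right_mono mult_left_mono power_mono) auto
      finally have "l1_norm (L *\<^sub>R f t - \<theta> - m) \<le> \<epsilon>" using err by linarith
      with m t r show ?thesis by force
    qed
  qed
  ultimately show ?thesis by blast
qed

end
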